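(* Let $\varphi$ be a CNF and let $(T,\{B(t)\})$ be a one-sided tree decomposition of the incidence graph of $\varphi$, with $T$ a rooted binary tree. Let $x$ be a node of $T$, let $CL'\subseteq CL(x)$, let $S$ be an assignment to $Var(par(x))$, and suppose $\Phi(x,CL',S)$ is unsatisfiable. Let $S'$ be an assignment to $Var(x)\setminus Var(par(x))$. Then one of the following holds: (1) $\Phi(x,CL',S)|_{S'}$ contains the empty clause; (2) there is a child $y$ of $x$ such that the $y$-component of $\Phi(x,CL',S)$ through $S'$ is unsatisfiable.
   Context: A CNF is a set of clauses, a clause a set of literals; sets of literals never contain a literal together with its negation, and an assignment to a set $V$ of variables is a set of literals whose variables are exactly $V$. A set $S$ of literals satisfies a clause $C$ if $C\cap S\neq\emptyset$; otherwise $C|_S=C\setminus\{\neg\ell:\ell\in S\}$. For a CNF $\psi$, $\psi|_S$ is the set of all $C|_S$ with $C\in\psi$ not satisfied by $S$. For a set $C$ of literals and a set $V$ of variables, $Proj(C,V)$ is the set of literals of $C$ whose variable lies in $V$. The incidence graph of $\varphi$ has the variables and clauses of $\varphi$ as vertices, $x$ adjacent to $C$ iff $x$ occurs in $C$. A tree decomposition of it with rooted $T$ is one-sided if for each clause $C$ the nodes whose bags contain $C$ induce a directed (ancestor-to-descendant) path. For a node $t$, $Var(t)$ and $CL(t)$ are the variables and clauses in $B(t)$; $T_t$ is the subtree of $T$ consisting of $t$ and its descendants and $Var(T_t)=\bigcup_{u\in V(T_t)}Var(u)$; $par(t)$ is the parent of $t$, and $Var(par(t))=\emptyset$ if $t$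 is the root. For a node $x$ and a set $CL'$ of clauses, $\Phi(x,CL')$ is obtained from $\varphi\setminus CL'$ by deleting every clause $C$ with no variable in $Var(T_x)$ and replacing each remaining clause $C$ by $Proj(C,Var(T_x))$; for a set $S$ of literals, $\Phi(x,CL',S)=\Phi(x,CL')|_S$. For $x$, $CL'$, $S$ as in the claim, an assignment $S'$ to $Var(x)\setminus Var(par(x))$ and a child $y$ of $x$: let $S_y=Proj(S\cup S',Var(x)\cap Var(y))$ and let $CL_y$ consist of the clauses in $CL'\cap CL(y)$ together with the clauses of $CL(y)$ satisfied by $S\cup S'$; the $y$-component of $\Phi(x,CL',S)$ through $S'$ is $\Phi(y,CL_y,S_y)$.
   Formalization: As literally stated the claim fails when S satisfies a clause of CL(y) only through variables outside Var(x); here, in CL_y, a clause C of CL(y) counts as satisfied by S∪S' when Proj(C,Var(T_x)) is satisfied by S∪S'. *)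

theory Defs
  imports Main
begin

datatype 'v literal = Pos (lvar: 'v) | Neg (lvar: 'v)

fun neg :: "'v literal \<Rightarrow> 'v literal" where
  "neg (Pos v) = Neg v"
| "neg (Neg v) = Pos v"

type_synonym 'v clause = "'v literal set"
type_synonym 'v cnf = "'v clause set"

definition consistent :: "'v literal set \<Rightarrow> bool" where
  "consistent S \<longleftrightarrow> (\<forall>l\<in>S. neg l \<notin> S)"

definition is_cnf :: "'v cnf \<Rightarrow> bool" where
  "is_cnf \<phi> \<longleftrightarrow> finite \<phi> \<and> (\<forall>C\<in>\<phi>. finite C \<and> consistent C)"

definition lits_vars :: "'v literal set \<Rightarrow> 'v set" where
  "lits_vars C = lvar ` C"

definition cnf_vars :: "'v cnf \<Rightarrow> 'v set" where
  "cnf_vars \<phi> = (\<Union>C\<in>\<phi>. lits_vars C)"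

definition assignment :: "'v literal set \<Rightarrow> 'v set \<Rightarrow> bool" where
  "assignment S V \<longleftrightarrow> consistent S \<and> lits_vars S = V"

definition satisfies :: "'v literal set \<Rightarrow> 'v clause \<Rightarrow> bool" where
  "satisfies S C \<longleftrightarrow> C \<inter> S \<noteq> {}"

definition satisfiable :: "'v cnf \<Rightarrow> bool" where
  "satisfiable \<psi> \<longleftrightarrow> (\<exists>A. assignment A (cnf_vars \<psi>) \<and> (\<forall>C\<in>\<psi>. satisfies A C))"

definition clause_restrict :: "'v clause \<Rightarrow> 'v literal set \<Rightarrow> 'v clause" where
  "clause_restrict C S = C - neg ` S"

definition cnf_restrict :: "'v cnf \<Rightarrow> 'v literal set \<Rightarrow> 'v cnf" where
  "cnf_restrict \<psi> S = {clause_restrict C S | C. C \<in> \<psi> \<and> \<not> satisfies S C}"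

definition Proj :: "'v literal set \<Rightarrow> 'v set \<Rightarrow> 'v literal set" where
  "Proj C V = {l \<in> C. lvar l \<in> V}"


text \<open>Arcs of a rooted tree point from parent to child.\<close>

record 't rtree =
  nodes :: "'t set"
  root :: 't
  arcs :: "('t \<times> 't) set"

definition children :: "'t rtree \<Rightarrow> 't \<Rightarrow> 't set" where
  "children T t = {y. (t, y) \<in> arcs T}"

definition par :: "'t rtree \<Rightarrow> 't \<Rightarrow> 't" where
  "par T t = (THE s. (s, t) \<in> arcs T)"

definition subtree_nodes :: "'t rtree \<Rightarrow> 't \<Rightarrow> 't set" where
  "subtree_nodes T t = {u. (t, u) \<in> (arcs T)\<^sup>*}"

definition rooted_tree :: "'t rtree \<Rightarrow> bool" where
  "rooted_tree T \<longleftrightarrow>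
     finite (nodes T) \<and> root T \<in> nodes T \<and> arcs T \<subseteq> nodes T \<times> nodes T \<and>
     (\<forall>s. (s, root T) \<notin> arcs T) \<and>
     (\<forall>t \<in> nodes T - {root T}. \<exists>!s. (s, t) \<in> arcs T) \<and>
     (\<forall>t \<in> nodes T. (root T, t) \<in> (arcs T)\<^sup>*)"

definition rooted_binary_tree :: "'t rtree \<Rightarrow> bool" where
  "rooted_binary_tree T \<longleftrightarrow> rooted_tree T \<and> (\<forall>t \<in> nodes T. card (children T t) \<le> 2)"

definition connected_nodes :: "'t rtree \<Rightarrow> 't set \<Rightarrow> bool" where
  "connected_nodes T X \<longleftrightarrow>
     (\<forall>s\<in>X. \<forall>t\<in>X. (s, t) \<in> ((arcs T \<union> (arcs T)\<inverse>) \<inter> X \<times> X)\<^sup>*)"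

definition induces_directed_path :: "'t rtree \<Rightarrow> 't set \<Rightarrow> bool" where
  "induces_directed_path T X \<longleftrightarrow>
     (\<exists>p. distinct p \<and> set p = X \<and>
          arcs T \<inter> X \<times> X = {(p ! i, p ! Suc i) | i. Suc i < length p})"

definition tree_decomposition ::
  "'a set \<Rightarrow> 'a set set \<Rightarrow> 't rtree \<Rightarrow> ('t \<Rightarrow> 'a set) \<Rightarrow> bool" where
  "tree_decomposition V Ed T B \<longleftrightarrow>
     rooted_tree T \<and>
     (\<forall>t \<in> nodes T. B t \<subseteq> V) \<and>
     (\<forall>v \<in> V. \<exists>t \<in> nodes T. v \<in> B t) \<and>
     (\<forall>e \<in> Ed. \<exists>t \<in> nodes T. e \<subseteq> B t) \<and>
     (\<forall>v \<in> V. connected_nodes T {t \<in> nodes T. v \<in> B t})"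


type_synonym 'v inc_vertex = "'v + 'v clause"

definition incidence_vertices :: "'v cnf \<Rightarrow> 'v inc_vertex set" where
  "incidence_vertices \<phi> = Inl ` cnf_vars \<phi> \<union> Inr ` \<phi>"

definition incidence_edges :: "'v cnf \<Rightarrow> 'v inc_vertex set set" where
  "incidence_edges \<phi> = {{Inl v, Inr C} | v C. C \<in> \<phi> \<and> v \<in> lits_vars C}"

definition one_sided_decomposition ::
  "'v cnf \<Rightarrow> 't rtree \<Rightarrow> ('t \<Rightarrow> 'v inc_vertex set) \<Rightarrow> bool" where
  "one_sided_decomposition \<phi> T B \<longleftrightarrow>
     tree_decomposition (incidence_vertices \<phi>) (incidence_edges \<phi>) T B \<and>
     (\<forall>C\<in>\<phi>. induces_directed_path T {t \<in> nodes T. Inr C \<in> B t})"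

definition Var :: "('t \<Rightarrow> 'v inc_vertex set) \<Rightarrow> 't \<Rightarrow> 'v set" where
  "Var B t = {v. Inl v \<in> B t}"

definition CL :: "('t \<Rightarrow> 'v inc_vertex set) \<Rightarrow> 't \<Rightarrow> 'v clause set" where
  "CL B t = {C. Inr C \<in> B t}"

definition VarT :: "'t rtree \<Rightarrow> ('t \<Rightarrow> 'v inc_vertex set) \<Rightarrow> 't \<Rightarrow> 'v set" where
  "VarT T B t = (\<Union>u \<in> subtree_nodes T t. Var B u)"

definition Var_par :: "'t rtree \<Rightarrow> ('t \<Rightarrow> 'v inc_vertex set) \<Rightarrow> 't \<Rightarrow> 'v set" where
  "Var_par T B t = (if t = root T then {} else Var B (par T t))"

definition Phi ::
  "'v cnf \<Rightarrow> 't rtree \<Rightarrow> ('t \<Rightarrow> 'v inc_vertex set) \<Rightarrow> 't \<Rightarrow> 'v clause set \<Rightarrow> 'v cnf" where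
  "Phi \<phi> T B x CL' =
     {Proj C (VarT T B x) | C. C \<in> \<phi> - CL' \<and> lits_vars C \<inter> VarT T B x \<noteq> {}}"

definition Phi_restrict ::
  "'v cnf \<Rightarrow> 't rtree \<Rightarrow> ('t \<Rightarrow> 'v inc_vertex set) \<Rightarrow> 't \<Rightarrow> 'v clause set \<Rightarrow> 'v literal set \<Rightarrow> 'v cnf"
  where
  "Phi_restrict \<phi> T B x CL' S = cnf_restrict (Phi \<phi> T B x CL') S"

definition comp_assignment ::
  "('t \<Rightarrow> 'v inc_vertex set) \<Rightarrow> 't \<Rightarrow> 'v literal set \<Rightarrow> 'v literal set \<Rightarrow> 't \<Rightarrow> 'v literal set" where
  "comp_assignment B x S S' y = Proj (S \<union> S') (Var B x \<inter> Var B y)"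

text \<open>
  A clause \<open>C\<close> counts as satisfied by \<open>S \<union> S'\<close> when its occurrence \<open>Proj C (VarT T B x)\<close> in
  \<open>Phi \<phi> T B x CL'\<close> is satisfied.  This differs from \<open>satisfies (S \<union> S') C\<close> only if \<open>C\<close> meets \<open>S\<close>
  solely in literals of variables outside the bag of \<open>x\<close>; such a \<open>C\<close> is not satisfied by \<open>S\<close> in
  \<open>Phi \<phi> T B x CL'\<close>, and dropping it from the components makes the claimed
  alternative fail.  Example: clauses \<open>C = {Pos v, Pos a}\<close> and \<open>D = {Neg a}\<close>, bags \<open>{v, C}\<close>,
  \<open>{C}\<close>, \<open>{C, a, D}\<close> along a path from the root, \<open>x\<close> the middle node, \<open>CL' = {}\<close>, \<open>S = {Pos v}\<close>,
  \<open>S' = {}\<close>.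
\<close>

definition comp_clauses ::
  "'t rtree \<Rightarrow> ('t \<Rightarrow> 'v inc_vertex set) \<Rightarrow> 't \<Rightarrow> 'v clause set \<Rightarrow> 'v literal set \<Rightarrow> 'v literal set \<Rightarrow>
     't \<Rightarrow> 'v clause set" where
  "comp_clauses T B x CL' S S' y =
     (CL' \<inter> CL B y) \<union> {C \<in> CL B y. satisfies (S \<union> S') (Proj C (VarT T B x))}"

definition component ::
  "'v cnf \<Rightarrow> 't rtree \<Rightarrow> ('t \<Rightarrow> 'v inc_vertex set) \<Rightarrow> 't \<Rightarrow> 'v clause set \<Rightarrow> 'v literal set \<Rightarrow>
     'v literal set \<Rightarrow> 't \<Rightarrow> 'v cnf" where
  "component \<phi> T B x CL' S S' y =
     Phi_restrict \<phi> T B y (comp_clauses T B x CL' S S' y) (comp_assignment B x S S' y)"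

end

theory Submission
  imports Defs
begin

text \<open>
  Contrapositive: choose a satisfying assignment \<open>A y\<close> of every component and glue them together
  with \<open>S'\<close>. The bag of \<open>x\<close> separates the subtrees of its children from each other and from
  \<open>par T x\<close>, so the union is consistent. A clause that \<open>S \<union> S'\<close> neither satisfies nor empties
  keeps a literal whose variable lies below some child \<open>y\<close>; hence it survives in the
  \<open>y\<close>-component and is satisfied by \<open>A y\<close>.
\<close>

section \<open>Literals, consistency and satisfiability\<close>

lemma neg_neg [simp]: "neg (neg l) = l"
  by (cases l) auto

lemma lvar_neg [simp]: "lvar (neg l) = lvar l"
  by (cases l) auto

lemma lvar_eq_cases: "lvar l = lvar m \<Longrightarrow> l = m \<or> l = neg m"
  by (cases l; cases m) auto

lemma lits_vars_cases:
  assumes "lvar l \<in> lits_vars S"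
  shows "l \<in> S \<or> l \<in> neg ` S"
  using assms unfolding lits_vars_def by (auto dest: lvar_eq_cases)

lemma consistent_UnI:
  assumes "consistent A" "consistent A'" "lits_vars A \<inter> lits_vars A' = {}"
  shows "consistent (A \<union> A')"
  using assms unfolding consistent_def lits_vars_def disjoint_iff
  by (metis Un_iff imageI lvar_neg)

text \<open>\<open>satisfiable\<close> asks for an assignment to exactly
  \<open>cnf_vars \<psi>\<close>. The glued assignment may cover too many variables or too few, and
  this lemma repairs both.\<close>

lemma satisfiable_if_consistent:
  assumes "consistent A" and sat: "\<And>C. C \<in> \<psi> \<Longrightarrow> satisfies A C"
  shows "satisfiable \<psi>"
proof -
  \<comment> \<open>Literals over foreign variables are dropped; variables that \<open>A\<close>
    leaves open default to positive.\<close>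
  define A' where "A' = Proj A (cnf_vars \<psi>) \<union> Pos ` (cnf_vars \<psi> - lits_vars A)"
  have "consistent A'"
    unfolding A'_def
  proof (rule consistent_UnI)
    show "consistent (Proj A (cnf_vars \<psi>))"
      using assms(1) by (auto simp: consistent_def Proj_def)
    show "consistent (Pos ` (cnf_vars \<psi> - lits_vars A))"
      by (auto simp: consistent_def)
    show "lits_vars (Proj A (cnf_vars \<psi>)) \<inter> lits_vars (Pos ` (cnf_vars \<psi> - lits_vars A)) = {}"
      by (auto simp: lits_vars_def Proj_def)
  qed
  moreover have "lits_vars A' = cnf_vars \<psi>"
    unfolding A'_def lits_vars_def Proj_def by (auto simp: image_Un image_image)
  moreover have "satisfies A' C" if "C \<in> \<psi>" for C
    using sat[OF that] that unfolding A'_def satisfies_def Proj_def cnf_vars_def lits_vars_def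
    by auto
  ultimately show ?thesis
    unfolding satisfiable_def assignment_def by blast
qed

section \<open>Paths and subtrees in a rooted tree\<close>

context
  fixes T :: "'t rtree"
  assumes tree: "rooted_tree T"
begin

lemma arcs_unique_parent: "(s, t) \<in> arcs T \<Longrightarrow> (s', t) \<in> arcs T \<Longrightarrow> s = s'"
  using tree unfolding rooted_tree_def by (cases "t = root T") blast+

lemma par_eq: "(s, t) \<in> arcs T \<Longrightarrow> par T t = s"
  unfolding par_def using arcs_unique_parent by blast

lemma arcs_nodes: "(s, t) \<in> arcs T \<Longrightarrow> s \<in> nodes T \<and> t \<in> nodes T"
  using tree unfolding rooted_tree_def by blast

lemma par_arc:
  assumes "t \<in> nodes T" "t \<noteq> root T"
  shows "(par T t, t) \<in> arcs T"
proof -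
  obtain s where "(s, t) \<in> arcs T"
    using tree assms unfolding rooted_tree_def by blast
  then show ?thesis using par_eq by simp
qed

lemma subtree_nodes_subset:
  assumes "t \<in> nodes T"
  shows "subtree_nodes T t \<subseteq> nodes T"
proof
  fix u assume "u \<in> subtree_nodes T t"
  then have "(t, u) \<in> (arcs T)\<^sup>*" by (simp add: subtree_nodes_def)
  then show "u \<in> nodes T"
    by (induction rule: rtrancl_induct) (use assms arcs_nodes in auto)
qed

text \<open>By uniqueness of parents, the last arc of the path into \<open>u\<close> starts at
  \<open>p\<close>.\<close>

lemma arcs_rtrancl_parent:
  assumes "(y, u) \<in> (arcs T)\<^sup>*" "u \<noteq> y" "(p, u) \<in> arcs T"
  shows "(y, p) \<in> (arcs T)\<^sup>*"
  using assms arcs_unique_parent by (metis rtranclE)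

text \<open>Induction down from the root, which has no incoming arc: a cycle through a child enters
  it from its only parent, so it is also a cycle through that parent.\<close>

lemma arcs_acyclic:
  assumes "t \<in> nodes T"
  shows "(t, t) \<notin> (arcs T)\<^sup>+"
proof -
  have "(root T, t) \<in> (arcs T)\<^sup>*"
    using tree assms unfolding rooted_tree_def by blast
  then show ?thesis
  proof (induction rule: rtrancl_induct)
    case base
    show ?case
      using tree unfolding rooted_tree_def by (metis tranclE)
  next
    case (step t t')
    show ?case
    proof
      assume "(t', t') \<in> (arcs T)\<^sup>+"
      then obtain s where "(t', s) \<in> (arcs T)\<^sup>*" "(s, t') \<in> arcs T"
        by (meson tranclD2)
      then have "(t', t) \<in> (arcs T)\<^sup>*"
        using arcs_unique_parent step.hyps(2) by metis
      then show False
        using step.hyps(2) step.IH by (meson rtrancl_into_trancl2)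
    qed
  qed
qed

lemma parent_notin_subtree:
  assumes "(x, y) \<in> arcs T"
  shows "x \<notin> subtree_nodes T y"
  using assms arcs_acyclic[of x] arcs_nodes[OF assms]
  unfolding subtree_nodes_def by (auto dest: rtrancl_into_trancl2)

text \<open>Ancestors of a common node are comparable, so one sibling would lie above the other and
  hence above their parent \<open>x\<close>.\<close>

lemma subtree_siblings_disjoint:
  assumes y: "(x, y) \<in> arcs T" and y': "(x, y') \<in> arcs T" and "y \<noteq> y'"
  shows "subtree_nodes T y \<inter> subtree_nodes T y' = {}"
proof (rule ccontr)
  assume "\<not> ?thesis"
  then obtain u where u: "(y, u) \<in> (arcs T)\<^sup>*" "(y', u) \<in> (arcs T)\<^sup>*"
    unfolding subtree_nodes_def by blast
  \<comment> \<open>Upward paths are deterministic, so of the two paths from \<open>u\<close> one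
    prolongs the other.\<close>
  have "single_valued ((arcs T)\<inverse>)"
    using arcs_unique_parent by (auto simp: single_valued_def)
  moreover have "(u, y) \<in> ((arcs T)\<inverse>)\<^sup>*" "(u, y') \<in> ((arcs T)\<inverse>)\<^sup>*"
    using u by (simp_all add: rtrancl_converse)
  ultimately have "(y, y') \<in> ((arcs T)\<inverse>)\<^sup>* \<or> (y', y) \<in> ((arcs T)\<inverse>)\<^sup>*"
    by (rule single_valued_confluent)
  then have "(y', y) \<in> (arcs T)\<^sup>* \<or> (y, y') \<in> (arcs T)\<^sup>*"
    by (simp add: rtrancl_converse)
  then have "(y', x) \<in> (arcs T)\<^sup>* \<or> (y, x) \<in> (arcs T)\<^sup>*"
    using arcs_rtrancl_parent assms by metis
  then show False
    using parent_notin_subtree y y' unfolding subtree_nodes_def by blast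
qed

text \<open>The arc from \<open>p\<close> to \<open>y\<close> is the only link between the subtree
  of \<open>y\<close> and the other nodes, so a walk within \<open>X\<close> from \<open>u\<close>
  to \<open>w\<close> has to use it.\<close>

lemma connected_nodes_cross_arc:
  assumes conn: "connected_nodes T X" and "u \<in> X" "w \<in> X"
    and u: "u \<in> subtree_nodes T y" and w: "w \<notin> subtree_nodes T y"
    and p: "(p, y) \<in> arcs T"
  shows "y \<in> X \<and> p \<in> X"
proof -
  have "(u, w) \<in> ((arcs T \<union> (arcs T)\<inverse>) \<inter> X \<times> X)\<^sup>*"
    using conn \<open>u \<in> X\<close> \<open>w \<in> X\<close> unfolding connected_nodes_def by blast
  then have "w \<in> subtree_nodes T y \<or> y \<in> X \<and> p \<in> X"
  proof (induction rule: rtrancl_induct)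
    case base
    show ?case using u by blast
  next
    case (step a b)
    show ?case
    proof (cases "a \<in> subtree_nodes T y \<and> b \<notin> subtree_nodes T y")
      case True
      \<comment> \<open>Downward arcs stay in the subtree, so the walk leaves it upward, and only
        \<open>y\<close> has its parent outside.\<close>
      then have "(b, a) \<in> arcs T"
        using step.hyps(2) unfolding subtree_nodes_def by (auto intro: rtrancl_into_rtrancl)
      moreover from this have "a = y"
        using True arcs_rtrancl_parent unfolding subtree_nodes_def by blast
      ultimately show ?thesis
        using step.hyps(2) p arcs_unique_parent by blast
    qed (use step.IH in blast)
  qed
  then show ?thesis using w by blast
qed

lemma VarT_children:
  "VarT T B x = Var B x \<union> (\<Union>y \<in> children T x. VarT T B y)"
proof -
  have "subtree_nodes T x = insert x (\<Union>y \<in> children T x. subtree_nodes T y)"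
    unfolding subtree_nodes_def children_def set_eq_iff
    by (auto intro: converse_rtrancl_into_rtrancl) (metis converse_rtranclE)
  then show ?thesis by (auto simp: VarT_def)
qed

end

section \<open>Separation of variables by bags\<close>

lemma tree_decomposition_rooted_tree: "tree_decomposition V Ed T B \<Longrightarrow> rooted_tree T"
  by (simp add: tree_decomposition_def)

text \<open>The nodes whose bags contain \<open>v\<close> are connected and lie on both sides of the
  arc from \<open>p\<close> to \<open>y\<close>, so they include both of its ends.\<close>

lemma VarT_separation:
  assumes td: "tree_decomposition V Ed T B" and arc: "(p, y) \<in> arcs T"
    and v: "v \<in> VarT T B y" "v \<in> Var B w"
    and w: "w \<in> nodes T" "w \<notin> subtree_nodes T y"
  shows "v \<in> Var B y \<and> v \<in> Var B p"
proof -
  note tree = tree_decomposition_rooted_tree[OF td]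
  obtain u where u: "u \<in> subtree_nodes T y" "Inl v \<in> B u"
    using v(1) by (auto simp: VarT_def Var_def)
  have "u \<in> nodes T"
    using u(1) subtree_nodes_subset[OF tree] arcs_nodes[OF tree arc] by blast
  moreover have "connected_nodes T {t \<in> nodes T. Inl v \<in> B t}"
    using td w(1) v(2) unfolding tree_decomposition_def Var_def by blast
  ultimately show ?thesis
    using connected_nodes_cross_arc[OF tree, of _ u w y p] u v(2) w arc
    by (auto simp: Var_def)
qed

lemma VarT_child_inter_Var:
  assumes "tree_decomposition V Ed T B" and "(x, y) \<in> arcs T"
  shows "VarT T B y \<inter> Var B x \<subseteq> Var B y"
  using VarT_separation[OF assms, of _ x] assms(2)
    parent_notin_subtree[OF tree_decomposition_rooted_tree[OF assms(1)]]
    arcs_nodes[OF tree_decomposition_rooted_tree[OF assms(1)]] by auto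

text \<open>Used to see that \<open>S\<close> decides no variable that occurs below \<open>x\<close>
  but is missing from the bag of \<open>x\<close>.\<close>

lemma VarT_inter_Var_par:
  assumes td: "tree_decomposition V Ed T B" and "x \<in> nodes T"
  shows "VarT T B x \<inter> Var_par T B x \<subseteq> Var B x"
proof (cases "x = root T")
  case False
  then show ?thesis
    using VarT_child_inter_Var[OF td] par_arc[OF tree_decomposition_rooted_tree[OF td]] assms(2)
    by (simp add: Var_par_def)
qed (simp add: Var_par_def)

text \<open>An occurrence below \<open>y'\<close> lies outside the subtree of \<open>y\<close>, so
  separation at the arc from \<open>x\<close> to \<open>y\<close> applies.\<close>

lemma VarT_siblings_inter:
  assumes td: "tree_decomposition V Ed T B"
    and y: "(x, y) \<in> arcs T" and y': "(x, y') \<in> arcs T" and "y \<noteq> y'"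
  shows "VarT T B y \<inter> VarT T B y' \<subseteq> Var B x"
proof
  fix v assume v: "v \<in> VarT T B y \<inter> VarT T B y'"
  note tree = tree_decomposition_rooted_tree[OF td]
  obtain w where w: "w \<in> subtree_nodes T y'" "v \<in> Var B w"
    using v by (auto simp: VarT_def)
  then have "w \<notin> subtree_nodes T y" "w \<in> nodes T"
    using subtree_siblings_disjoint[OF tree y y' \<open>y \<noteq> y'\<close>]
      subtree_nodes_subset[OF tree] arcs_nodes[OF tree y'] by blast+
  then show "v \<in> Var B x"
    using VarT_separation[OF td y] v w(2) by blast
qed

section \<open>Variables left in a component, and consistency of unions\<close>

lemma cnf_vars_Phi_restrict:
  "cnf_vars (Phi_restrict \<phi> T B x CL' S) \<subseteq> VarT T B x - lits_vars S"
proof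
  fix v assume "v \<in> cnf_vars (Phi_restrict \<phi> T B x CL' S)"
  then obtain C l where "l \<in> Proj C (VarT T B x)" "l \<notin> neg ` S" "lvar l = v"
    "\<not> satisfies S (Proj C (VarT T B x))"
    unfolding cnf_vars_def Phi_restrict_def cnf_restrict_def clause_restrict_def Phi_def
      lits_vars_def by blast
  \<comment> \<open>A literal of \<open>S\<close> would have satisfied the clause; with its negation
    excluded too, \<open>S\<close> leaves the variable open.\<close>
  moreover from this have "l \<notin> S"
    by (auto simp: satisfies_def)
  ultimately show "v \<in> VarT T B x - lits_vars S"
    using lits_vars_cases[of l S] by (auto simp: Proj_def)
qed

text \<open>By separation, every variable of the bag of \<open>x\<close> occurring below
  \<open>y\<close> is in the bag of \<open>y\<close>, hence decided by
  \<open>comp_assignment\<close>.\<close>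

lemma cnf_vars_component:
  assumes td: "tree_decomposition V Ed T B" and y: "(x, y) \<in> arcs T"
    and vars: "Var B x \<subseteq> lits_vars (S \<union> S')"
  shows "cnf_vars (component \<phi> T B x CL' S S' y) \<subseteq> VarT T B y - Var B x"
proof -
  have "Var B x \<inter> Var B y \<subseteq> lits_vars (comp_assignment B x S S' y)"
    using vars by (force simp: comp_assignment_def lits_vars_def Proj_def)
  then show ?thesis
    using cnf_vars_Phi_restrict[of \<phi> T B y "comp_clauses T B x CL' S S' y"
        "comp_assignment B x S S' y"]
      VarT_child_inter_Var[OF td y]
    unfolding component_def by blast
qed

lemma consistent_UNI:
  assumes "\<And>i. i \<in> I \<Longrightarrow> consistent (A i)"
    and "\<And>i j. i \<in> I \<Longrightarrow> j \<in> I \<Longrightarrow> i \<noteq> j \<Longrightarrow> lits_vars (A i) \<inter> lits_vars (A j) = {}"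
  shows "consistent (\<Union>i\<in>I. A i)"
  unfolding consistent_def
proof (intro ballI notI)
  fix l assume "l \<in> (\<Union>i\<in>I. A i)" "neg l \<in> (\<Union>i\<in>I. A i)"
  then obtain i j where ij: "i \<in> I" "j \<in> I" "l \<in> A i" "neg l \<in> A j" by blast
  then have "lvar l \<in> lits_vars (A i) \<inter> lits_vars (A j)"
    unfolding lits_vars_def by (metis IntI image_eqI lvar_neg)
  then have "i = j" using assms(2) ij by blast
  then show False using assms(1) ij unfolding consistent_def by blast
qed

section \<open>Gluing the assignments of the components\<close>

theorem theorem3:
  fixes \<phi> :: "'v cnf" and T :: "'t rtree" and B :: "'t \<Rightarrow> 'v inc_vertex set"
    and x :: 't and CL' :: "'v clause set" and S S' :: "'v literal set"
  assumes "is_cnf \<phi>"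
    and "rooted_binary_tree T"
    and "one_sided_decomposition \<phi> T B"
    and "x \<in> nodes T"
    and "CL' \<subseteq> CL B x"
    and "assignment S (Var_par T B x)"
    and "\<not> satisfiable (Phi_restrict \<phi> T B x CL' S)"
    and "assignment S' (Var B x - Var_par T B x)"
  shows "{} \<in> cnf_restrict (Phi_restrict \<phi> T B x CL' S) S' \<or>
    (\<exists>y \<in> children T x. \<not> satisfiable (component \<phi> T B x CL' S S' y))"
proof (rule ccontr)
  assume neither: "\<not> ?thesis"
  let ?\<Psi> = "component \<phi> T B x CL' S S'"
  have td: "tree_decomposition (incidence_vertices \<phi>) (incidence_edges \<phi>) T B"
    using assms(3) by (simp add: one_sided_decomposition_def)
  note tree = tree_decomposition_rooted_tree[OF td]
  have S: "lits_vars S = Var_par T B x"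
    and S': "consistent S'" "lits_vars S' = Var B x - Var_par T B x"
    using assms(6,8) by (simp_all add: assignment_def)
  have "lits_vars (S \<union> S') = lits_vars S \<union> lits_vars S'"
    by (simp add: lits_vars_def image_Un)
  then have SS': "lits_vars (S \<union> S') = Var_par T B x \<union> Var B x"
    using S S' by blast
  have "\<forall>y\<in>children T x. \<exists>A. assignment A (cnf_vars (?\<Psi> y)) \<and> (\<forall>C\<in>?\<Psi> y. satisfies A C)"
    using neither by (auto simp: satisfiable_def)
  then obtain A where A: "\<And>y. y \<in> children T x \<Longrightarrow> assignment (A y) (cnf_vars (?\<Psi> y))"
    and A_sat: "\<And>y C. y \<in> children T x \<Longrightarrow> C \<in> ?\<Psi> y \<Longrightarrow> satisfies (A y) C"
    by metis
  have A_vars: "lits_vars (A y) \<subseteq> VarT T B y - Var B x" if "y \<in> children T x" for y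
    using A[OF that] cnf_vars_component[OF td, of x y S S' \<phi> CL'] that SS'
    by (auto simp: assignment_def children_def)
  \<comment> \<open>\<open>S\<close> is left out: the clauses to be satisfied are already restricted
    by it.\<close>
  define M where "M = S' \<union> (\<Union>y\<in>children T x. A y)"
  have "consistent (\<Union>y\<in>children T x. A y)"
  proof (rule consistent_UNI)
    show "consistent (A y)" if "y \<in> children T x" for y
      using A[OF that] by (simp add: assignment_def)
    \<comment> \<open>A shared variable would lie in the bag of \<open>x\<close>, which
      \<open>A_vars\<close> excludes.\<close>
    show "lits_vars (A y) \<inter> lits_vars (A y') = {}"
      if "y \<in> children T x" "y' \<in> children T x" "y \<noteq> y'" for y y'
      using VarT_siblings_inter[OF td, of x y y'] A_vars that by (fastforce simp: children_def)
  qed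
  moreover have "lits_vars (\<Union>y\<in>children T x. A y) = (\<Union>y\<in>children T x. lits_vars (A y))"
    by (auto simp: lits_vars_def)
  ultimately have "consistent M"
    unfolding M_def using S' A_vars by (intro consistent_UnI) auto
  moreover have "satisfies M C'" if C'_in: "C' \<in> Phi_restrict \<phi> T B x CL' S" for C'
  proof -
    obtain C where C: "C \<in> \<phi>" "C \<notin> CL'"
      and C': "C' = Proj C (VarT T B x) - neg ` S"
      and unsat: "\<not> satisfies S (Proj C (VarT T B x))"
      using C'_in unfolding Phi_restrict_def cnf_restrict_def clause_restrict_def Phi_def by blast
    show ?thesis
    proof (cases "satisfies S' C'")
      case True
      then show ?thesis unfolding M_def satisfies_def by blast
    next
      case False
      then have "clause_restrict C' S' \<in> cnf_restrict (Phi_restrict \<phi> T B x CL' S) S'"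
        using C'_in unfolding cnf_restrict_def by blast
      \<comment> \<open>The restricted clause is nonempty because the first alternative
        fails.\<close>
      then obtain l where l: "l \<in> C'" "l \<notin> neg ` S'"
        using neither unfolding clause_restrict_def by (metis DiffE ex_in_conv)
      \<comment> \<open>\<open>S\<close> and \<open>S'\<close> have disjoint variables, so a literal
        of \<open>S'\<close> in the projection survives the restriction by \<open>S\<close> and
        would satisfy \<open>C'\<close>.\<close>
      have unsat': "\<not> satisfies (S \<union> S') (Proj C (VarT T B x))"
      proof
        assume "satisfies (S \<union> S') (Proj C (VarT T B x))"
        then obtain m where m: "m \<in> Proj C (VarT T B x)" "m \<in> S'"
          using unsat by (auto simp: satisfies_def)
        then have "lvar m \<notin> lits_vars S"
          using S S' by (auto simp: lits_vars_def)
        then have "m \<notin> neg ` S"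
          by (auto simp: lits_vars_def)
        then show False
          using m False C' by (auto simp: satisfies_def)
      qed
      \<comment> \<open>\<open>S \<union> S'\<close> decides the whole bag of \<open>x\<close> but
        not \<open>l\<close>, so the variable of \<open>l\<close> must come from below some
        child.\<close>
      have "l \<notin> S \<union> S'" "l \<notin> neg ` (S \<union> S')"
        using l C' unsat' by (auto simp: satisfies_def)
      then have "lvar l \<notin> Var B x"
        using lits_vars_cases[of l "S \<union> S'"] SS' by blast
      moreover have "lvar l \<in> VarT T B x" "l \<in> C"
        using l C' by (auto simp: Proj_def)
      ultimately obtain y where y: "y \<in> children T x" "lvar l \<in> VarT T B y"
        using VarT_children[OF tree, of B x] by blast
      have sub: "Proj C (VarT T B y) \<subseteq> Proj C (VarT T B x)"
        using VarT_children[OF tree, of B x] y(1) by (auto simp: Proj_def)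
      \<comment> \<open>\<open>C\<close> is not removed: it is outside \<open>CL'\<close>, and
        \<open>unsat'\<close> negates the other condition in \<open>comp_clauses\<close>. The
        literal \<open>l\<close> provides a variable below \<open>y\<close>.\<close>
      have "Proj C (VarT T B y) \<in> Phi \<phi> T B y (comp_clauses T B x CL' S S' y)"
        using C unsat' y(2) \<open>l \<in> C\<close> unfolding Phi_def comp_clauses_def lits_vars_def by blast
      moreover have "\<not> satisfies (comp_assignment B x S S' y) (Proj C (VarT T B y))"
        using unsat' sub by (auto simp: satisfies_def comp_assignment_def Proj_def)
      ultimately have
        "clause_restrict (Proj C (VarT T B y)) (comp_assignment B x S S' y) \<in> ?\<Psi> y"
        unfolding component_def Phi_restrict_def cnf_restrict_def by blast
      then obtain m where m: "m \<in> Proj C (VarT T B y)" "m \<in> A y"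
        using A_sat[OF y(1)] unfolding satisfies_def clause_restrict_def by blast
      \<comment> \<open>It remains to check that \<open>m\<close> was not deleted from
        \<open>C'\<close> by \<open>S\<close>: its variable occurs below \<open>x\<close> but not in
        the bag of \<open>x\<close>, so it is not in the parent bag.\<close>
      have "lvar m \<notin> Var B x"
        using A_vars[OF y(1)] m(2) by (auto simp: lits_vars_def)
      then have "lvar m \<notin> lits_vars S"
        using VarT_inter_Var_par[OF td assms(4)] m(1) sub S by (auto simp: Proj_def)
      then have "m \<notin> neg ` S"
        by (auto simp: lits_vars_def)
      then show ?thesis
        using m sub y(1) C' unfolding M_def satisfies_def by blast
    qed
  qed
  ultimately show False
    using satisfiable_if_consistent assms(7) by blast
qed

end
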